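(* Let $A$ be a $\mathrm{QH}_t(m,n;h,k)$ that admits two compatible orderings $\omega_r$ and $\omega_c$. Then there exists a cellular biembedding $\psi$ of $K_{\frac{2nk+t}{t}\times t}$ into an orientable surface such that every edge is on a face whose boundary length is a multiple of $h$ and on a face whose boundary length is a multiple of $k$. Moreover, setting $v=2nk+t$, $\psi$ is $\mathbb{Z}_v$-regular.
   Context: Quasi-Heffter arrays. A partially filled (p.f.) array is a matrix in which some cells may be empty. Let $v=2nk+t$ where $t$ divides $2nk$, and let $J=\frac{v}{t}\mathbb{Z}_v$ be the subgroup of $\mathbb{Z}_v$ of order $t$. A quasi-Heffter array $\mathrm{QH}_t(m,n;h,k)$ is an $m\times n$ p.f. array $A$ with entries in $\mathbb{Z}_v$ such that each row contains exactly $h$ filled cells, each column contains exactly $k$ filled cells, and the multiset $[\pm x\mid x\in A]$ contains each element of $\mathbb{Z}_v\setminus J$ exactly once. $\mathcal{E}(A)$ denotes the list of entries of the filled cells of $A$. Compatible orderings. For each row $R_i$ (column $C_j$) choose a cyclic ordering $\omega_{R_i}$ ($\omega_{C_j}$) of its entries, viewed as a cyclic permutation. Put $\omega_r=\omega_{R_1}\circ\cdots\circ\omega_{R_m}$ and $\omega_c=\omega_{C_1}\circ\cdots\circ\omega_{C_n}$, permutations of $\mathcal{E}(A)$. They are compatible if $\omega_c\circ\omega_r$ is a single cycle of length $|\mathcal{E}(A)|$. Graph. $K_{\frac{v}{t}\times t}$ is the complete multipartite graph with $v/t$ parts each of size $t$. Embeddings. A cellular embedding of a connected graph $\Gamma$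 in a surface is one for which every face (connected component of the complement) is homeomorphic to an open disc. Cellular embeddings in orientable surfaces are equivalently described by pairs $(\Gamma,\rho)$, where $\rho$ is a rotation, i.e. a permutation of the oriented edges of the form $\rho(x,y)=(x,\rho_x(y))$ with each $\rho_x$ a cyclic permutation of all neighbours of $x$; the boundaries of the faces are traced by the orbits of $(x,y)\mapsto\rho(y,x)$, and the length of a face is the length of the orbit. A biembedding is an embedding whose faces can be coloured with two colours so that each edge lies on one face of each colour. An embedding is $\mathbb{Z}_v$-regular if its automorphism group contains a subgroup isomorphic to $\mathbb{Z}_v$ acting sharply transitively on the vertices; an automorphism is a graph automorphism mapping faces to faces. *)

theory Defs
  imports
    "HOL-Library.Multiset"
    "HOL-Combinatorics.Permutations"
    "HOL-Combinatorics.Orbits"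
    "HOL-Algebra.Bij"
    "HOL-Algebra.Elementary_Groups"
    "Graph_Theory.Pair_Digraph"
    "Graph_Theory.Digraph_Component"
begin

section \<open>Quasi-Heffter arrays\<close>

text \<open>
  An \<open>m \<times> n\<close> partially filled array is a function of the row index \<open>i < m\<close> and
  the column index \<open>j < n\<close>; \<open>None\<close> is an empty cell, and values outside the index range are
  irrelevant.  The elements of \<open>\<int>\<^sub>v\<close> are the residues \<open>0, \<dots>, v - 1\<close>, as in
  \<^const>\<open>integer_mod_group\<close>.
\<close>

type_synonym pf_array = "nat \<Rightarrow> nat \<Rightarrow> int option"

definition filled_cells :: "nat \<Rightarrow> nat \<Rightarrow> pf_array \<Rightarrow> (nat \<times> nat) set" where
  "filled_cells m n A = {(i, j). i < m \<and> j < n \<and> A i j \<noteq> None}"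

definition row_entries :: "nat \<Rightarrow> pf_array \<Rightarrow> nat \<Rightarrow> int set" where
  "row_entries n A i = {x. \<exists>j<n. A i j = Some x}"

definition col_entries :: "nat \<Rightarrow> pf_array \<Rightarrow> nat \<Rightarrow> int set" where
  "col_entries m A j = {x. \<exists>i<m. A i j = Some x}"

text \<open>
  The list of entries is rendered as a set: the entries of a quasi-Heffter array are pairwise
  distinct.
\<close>

definition entries :: "nat \<Rightarrow> nat \<Rightarrow> pf_array \<Rightarrow> int set" where
  "entries m n A = {x. \<exists>i<m. \<exists>j<n. A i j = Some x}"

text \<open>The multiset \<open>[\<plusminus>x | x \<in> A]\<close> over \<open>\<int>\<^sub>v\<close>; an entry with \<open>x = - x\<close> contributes twice.\<close>

definition pm_entries :: "nat \<Rightarrow> nat \<Rightarrow> nat \<Rightarrow> pf_array \<Rightarrow> int multiset" where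
  "pm_entries v m n A =
     (\<Sum>(i, j)\<in>filled_cells m n A.
        {# the (A i j), inv\<^bsub>integer_mod_group v\<^esub> (the (A i j)) #})"

text \<open>The subgroup \<open>(v/t) \<int>\<^sub>v\<close>, which has order \<open>t\<close> when \<open>t\<close> divides \<open>v > 0\<close>.\<close>

definition multiples_subgroup :: "nat \<Rightarrow> nat \<Rightarrow> int set" where
  "multiples_subgroup v t =
     (\<lambda>x. (int (v div t) * x) mod int v) ` carrier (integer_mod_group v)"

text \<open>
  The parameters are positive, as is implicit in the notion of an \<open>m \<times> n\<close> array with \<open>h\<close> filled
  cells per row and \<open>k\<close> per column; \<open>t > 0\<close> follows from \<open>t dvd 2 * n * k\<close>.
\<close>

definition quasi_heffter ::
  "nat \<Rightarrow> nat \<Rightarrow> nat \<Rightarrow> nat \<Rightarrow> nat \<Rightarrow> pf_array \<Rightarrow> bool" where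
  "quasi_heffter t m n h k A \<longleftrightarrow>
     m > 0 \<and> n > 0 \<and> h > 0 \<and> k > 0 \<and> t dvd 2 * n * k \<and>
     (let v = 2 * n * k + t in
       entries m n A \<subseteq> carrier (integer_mod_group v) \<and>
       (\<forall>i<m. card {j. j < n \<and> A i j \<noteq> None} = h) \<and>
       (\<forall>j<n. card {i. i < m \<and> A i j \<noteq> None} = k) \<and>
       (\<forall>x \<in> carrier (integer_mod_group v) - multiples_subgroup v t.
          count (pm_entries v m n A) x = 1))"


section \<open>Compatible orderings\<close>

definition cyclic_ordering :: "('a \<Rightarrow> 'a) \<Rightarrow> 'a set \<Rightarrow> bool" where
  "cyclic_ordering f S \<longleftrightarrow> f permutes S \<and> cyclic_on f S"

text \<open>Products of the form \<open>w 0 \<circ> w 1 \<circ> \<dots> \<circ> w (l - 1)\<close>.\<close>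

definition row_ordering :: "nat \<Rightarrow> nat \<Rightarrow> pf_array \<Rightarrow> (int \<Rightarrow> int) \<Rightarrow> bool" where
  "row_ordering m n A w_r \<longleftrightarrow>
     (\<exists>w. (\<forall>i<m. cyclic_ordering (w i) (row_entries n A i)) \<and>
          w_r = foldr (\<circ>) (map w [0..<m]) id)"

definition col_ordering :: "nat \<Rightarrow> nat \<Rightarrow> pf_array \<Rightarrow> (int \<Rightarrow> int) \<Rightarrow> bool" where
  "col_ordering m n A w_c \<longleftrightarrow>
     (\<exists>w. (\<forall>j<n. cyclic_ordering (w j) (col_entries m A j)) \<and>
          w_c = foldr (\<circ>) (map w [0..<n]) id)"

definition compatible_orderings ::
  "nat \<Rightarrow> nat \<Rightarrow> pf_array \<Rightarrow> (int \<Rightarrow> int) \<Rightarrow> (int \<Rightarrow> int) \<Rightarrow> bool" where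
  "compatible_orderings m n A w_r w_c \<longleftrightarrow>
     row_ordering m n A w_r \<and> col_ordering m n A w_c \<and>
     cyclic_ordering (w_c \<circ> w_r) (entries m n A)"


section \<open>Cellular embeddings in orientable surfaces\<close>

text \<open>
  A graph is a symmetric loop-free \<^typ>\<open>'a pair_pre_digraph\<close>; each edge is represented by its two
  orientations.
\<close>

definition complete_multipartite :: "nat \<Rightarrow> nat \<Rightarrow> (nat \<times> nat) pair_pre_digraph" where
  "complete_multipartite q t =
     \<lparr> pverts = {..<q} \<times> {..<t},
       parcs = {(x, y). x \<in> {..<q} \<times> {..<t} \<and> y \<in> {..<q} \<times> {..<t} \<and> fst x \<noteq> fst y} \<rparr>"

definition neighbours :: "'a pair_pre_digraph \<Rightarrow> 'a \<Rightarrow> 'a set" where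
  "neighbours G x = {y. (x, y) \<in> parcs G}"

definition rotation :: "'a pair_pre_digraph \<Rightarrow> ('a \<times> 'a \<Rightarrow> 'a \<times> 'a) \<Rightarrow> bool" where
  "rotation G \<rho> \<longleftrightarrow>
     \<rho> permutes parcs G \<and>
     (\<exists>r. \<forall>x\<in>pverts G. cyclic_ordering (r x) (neighbours G x) \<and>
            (\<forall>y\<in>neighbours G x. \<rho> (x, y) = (x, r x y)))"

text \<open>
  Cellular embeddings of connected graphs in orientable surfaces are represented by their rotation
  systems.
\<close>

definition cellular_embedding ::
  "'a pair_pre_digraph \<Rightarrow> ('a \<times> 'a \<Rightarrow> 'a \<times> 'a) \<Rightarrow> bool" where
  "cellular_embedding G \<rho> \<longleftrightarrow>
     pair_graph G \<and> Digraph_Component.connected (with_proj G) \<and> rotation G \<rho>"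

definition face_step :: "('a \<times> 'a \<Rightarrow> 'a \<times> 'a) \<Rightarrow> 'a \<times> 'a \<Rightarrow> 'a \<times> 'a" where
  "face_step \<rho> = (\<lambda>(x, y). \<rho> (y, x))"

text \<open>
  A face is the set of oriented edges traced along its boundary, so its boundary length is its
  cardinality.
\<close>

definition faces :: "'a pair_pre_digraph \<Rightarrow> ('a \<times> 'a \<Rightarrow> 'a \<times> 'a) \<Rightarrow> ('a \<times> 'a) set set" where
  "faces G \<rho> = orbit (face_step \<rho>) ` parcs G"

definition edge_on_face :: "'a \<times> 'a \<Rightarrow> ('a \<times> 'a) set \<Rightarrow> bool" where
  "edge_on_face e F \<longleftrightarrow> e \<in> F \<or> prod.swap e \<in> F"

definition biembedding :: "'a pair_pre_digraph \<Rightarrow> ('a \<times> 'a \<Rightarrow> 'a \<times> 'a) \<Rightarrow> bool" where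
  "biembedding G \<rho> \<longleftrightarrow>
     cellular_embedding G \<rho> \<and>
     (\<exists>colour :: ('a \<times> 'a) set \<Rightarrow> bool. \<forall>e\<in>parcs G. \<forall>c.
        \<exists>!F. F \<in> faces G \<rho> \<and> edge_on_face e F \<and> colour F = c)"


section \<open>Automorphisms and regular embeddings\<close>

text \<open>
  The boundary of a face as a closed walk: the list of successive vertices met when tracing it from
  the oriented edge \<open>d\<close>.
\<close>

definition boundary_walk :: "('a \<times> 'a \<Rightarrow> 'a \<times> 'a) \<Rightarrow> 'a \<times> 'a \<Rightarrow> 'a list" where
  "boundary_walk \<rho> d =
     map (\<lambda>i. fst ((face_step \<rho> ^^ i) d)) [0..<card (orbit (face_step \<rho>) d)]"

text \<open>
  All boundary walks of faces, with every starting point and both directions of traversal.  For an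
  automorphism to map faces to faces, it must preserve these walks and not merely the sets of
  oriented edges on the faces, because such a set does not determine the order of traversal.  The
  reversed walks are included so that orientation-reversing automorphisms are allowed.
\<close>

definition boundary_walks ::
  "'a pair_pre_digraph \<Rightarrow> ('a \<times> 'a \<Rightarrow> 'a \<times> 'a) \<Rightarrow> 'a list set" where
  "boundary_walks G \<rho> = boundary_walk \<rho> ` parcs G \<union> rev ` boundary_walk \<rho> ` parcs G"

definition embedding_automorphisms ::
  "'a pair_pre_digraph \<Rightarrow> ('a \<times> 'a \<Rightarrow> 'a \<times> 'a) \<Rightarrow> ('a \<Rightarrow> 'a) set" where
  "embedding_automorphisms G \<rho> =
     {\<sigma> \<in> Bij (pverts G).
        (\<forall>x\<in>pverts G. \<forall>y\<in>pverts G. (x, y) \<in> parcs G \<longleftrightarrow> (\<sigma> x, \<sigma> y) \<in> parcs G) \<and>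
        map \<sigma> ` boundary_walks G \<rho> = boundary_walks G \<rho>}"

definition embedding_aut_group ::
  "'a pair_pre_digraph \<Rightarrow> ('a \<times> 'a \<Rightarrow> 'a \<times> 'a) \<Rightarrow> ('a \<Rightarrow> 'a) monoid" where
  "embedding_aut_group G \<rho> = (BijGroup (pverts G))\<lparr>carrier := embedding_automorphisms G \<rho>\<rparr>"

text \<open>The property of being \<open>\<int>\<^sub>v\<close>-regular.\<close>

definition cyclic_regular ::
  "nat \<Rightarrow> 'a pair_pre_digraph \<Rightarrow> ('a \<times> 'a \<Rightarrow> 'a \<times> 'a) \<Rightarrow> bool" where
  "cyclic_regular v G \<rho> \<longleftrightarrow>
     (\<exists>H. subgroup H (embedding_aut_group G \<rho>) \<and>
          (embedding_aut_group G \<rho>)\<lparr>carrier := H\<rparr> \<cong> integer_mod_group v \<and>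
          (\<forall>x\<in>pverts G. \<forall>y\<in>pverts G. \<exists>!\<sigma>. \<sigma> \<in> H \<and> \<sigma> x = y))"

end

theory Submission
  imports Defs
begin

text \<open>
  The signed entries of the array are exactly the differences that generate the complete multipartite
  graph as a Cayley graph of \<open>\<int>\<^sub>v\<close>, so the same rotation of differences may be used at every vertex,
  and translations are then automorphisms.  The rotation sends an entry \<open>a\<close> to \<open>- w_r a\<close> and
  \<open>- a\<close> to \<open>w_c a\<close>.  Along a face, the differences then either are all entries, permuted by \<open>w_c\<close>,
  or are all negatives of entries, permuted like \<open>w_r\<close>: this gives both the colouring and the face
  lengths.
\<close>

text \<open>Passing to differences forgets the starting vertex, which is why face lengths are
  obtained only up to divisibility: when the differences have run once through a row or a column,
  the walk has moved by the signed sum of that line. Nothing forces this sum to vanish, so a face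
  may close only after several rounds. The signs in the rotation are dictated by face tracing, which
  reverses an oriented edge, and so negates its difference, before rotating. As the rotation changes
  sign as well, the sign is constant along a face, while the two orientations of an edge carry
  opposite signs. All this needs that no entry is the negative of an entry, itself included, which
  has to be extracted from the definition by counting.\<close>

section \<open>Orbits\<close>

text \<open>\<open>orbit f x\<close> starts at \<open>f x\<close>, so a return to \<open>x\<close>
  has to be proved. Extending \<open>f\<close> by the identity off \<open>A\<close> gives a
  permutation with the same orbit at \<open>x\<close>, since iteration from \<open>x\<close> never
  leaves \<open>A\<close>.\<close>

lemma inj_on_self_in_orbit:
  assumes "finite A" "f ` A \<subseteq> A" "inj_on f A" "x \<in> A"
  shows "x \<in> orbit f x"
proof -
  let ?g = "\<lambda>x. if x \<in> A then f x else x"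
  have "bij_betw f A A"
    using assms(1-3) by (simp add: bij_betw_def endo_inj_surj)
  then have "bij_betw ?g A A"
    by (rule bij_betw_cong[THEN iffD1, rotated]) auto
  then have "?g permutes A"
    by (rule bij_imp_permutes) auto
  then have "x \<in> orbit ?g x"
    using assms(1) permutation_self_in_orbit permutes_imp_permutation by metis
  moreover have "orbit f x = orbit ?g x"
    using assms by (intro orbit_cong0) auto
  ultimately show ?thesis by simp
qed

lemma orbit_eq_of_mem:
  assumes "x \<in> orbit f x" "y \<in> orbit f x"
  shows "orbit f y = orbit f x"
  by (rule orbit_cyclic_eq3[OF cyclic_on_singleI[OF assms(1) refl] assms(2)])

lemma card_orbit_eq_funpow_dist1:
  assumes "x \<in> orbit f x"
  shows "card (orbit f x) = funpow_dist1 f x x"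
  using card_image[OF inj_on_funpow_dist1[OF assms]] orbit_conv_funpow_dist1[OF assms] by simp

lemma funpow_card_orbit:
  assumes "x \<in> orbit f x"
  shows "(f ^^ card (orbit f x)) x = x"
  by (metis assms card_orbit_eq_funpow_dist1 funpow_dist1_prop)

text \<open>The size of a cycle is its least positive return time, and the remainder of
  \<open>l\<close> modulo that size would be a smaller one unless it is zero.\<close>

lemma card_cyclic_on_dvd:
  assumes "cyclic_on f S" "x \<in> S" "(f ^^ l) x = x"
  shows "card S dvd l"
proof -
  have orb: "orbit f x = S"
    by (rule orbit_cyclic_eq3) fact+
  then have self: "x \<in> orbit f x"
    using assms(2) by simp
  define p where "p = card S"
  have p: "p = funpow_dist1 f x x"
    using card_orbit_eq_funpow_dist1[OF self] orb by (simp add: p_def)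
  have "(f ^^ (l mod p)) x = x"
    using funpow_mod_eq[where f = f and n = p and x = x and m = l] funpow_card_orbit[OF self] orb assms(3) by (simp add: p_def)
  moreover have "l mod p < p"
    using p by simp
  ultimately have "l mod p = 0"
    using funpow_dist1_least[of "l mod p" f x x] p by (metis gr0I)
  then show ?thesis
    by (simp add: p_def mod_0_imp_dvd)
qed

section \<open>Products of permutations with disjoint supports\<close>

lemma foldr_comp_permutes:
  assumes "\<And>i. i \<in> set l \<Longrightarrow> w i permutes S i"
  shows "foldr (\<circ>) (map w l) id permutes (\<Union>i\<in>set l. S i)"
  using assms
proof (induction l)
  case Nil
  then show ?case by (simp add: id_def)
next
  case (Cons i l)
  have "foldr (\<circ>) (map w l) id permutes (\<Union>i\<in>set (i # l). S i)"
    by (rule permutes_subset[OF Cons.IH]) (use Cons.prems in auto)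
  moreover have "w i permutes (\<Union>i\<in>set (i # l). S i)"
    using Cons.prems[of i] by (rule permutes_subset) auto
  ultimately have "w i \<circ> foldr (\<circ>) (map w l) id permutes (\<Union>i\<in>set (i # l). S i)"
    by (rule permutes_compose)
  then show ?case
    by (simp add: comp_def[abs_def] id_def)
qed

text \<open>Factors to the right of \<open>w j\<close> fix \<open>x\<close>, and factors to its left
  fix \<open>w j x\<close>, which is still in \<open>S j\<close>.\<close>

lemma foldr_comp_apply:
  assumes "\<And>i. i \<in> set l \<Longrightarrow> w i permutes S i"
    and "\<And>i j. i \<in> set l \<Longrightarrow> j \<in> set l \<Longrightarrow> i \<noteq> j \<Longrightarrow> S i \<inter> S j = {}"
    and "distinct l" "j \<in> set l" "x \<in> S j"
  shows "foldr (\<circ>) (map w l) id x = w j x"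
  using assms
proof (induction l)
  case (Cons i l)
  let ?g = "foldr (\<circ>) (map w l) id"
  have g: "?g permutes (\<Union>i\<in>set l. S i)"
    using Cons.prems(1) by (intro foldr_comp_permutes) auto
  show ?case
  proof (cases "j = i")
    case True
    then have "x \<notin> (\<Union>i\<in>set l. S i)"
      using Cons.prems(2)[of i] Cons.prems(3,5) by fastforce
    then show ?thesis
      using permutes_not_in[OF g] True by (simp add: comp_def[abs_def] id_def)
  next
    case False
    then have j: "j \<in> set l" using Cons.prems by simp
    have "?g x = w j x"
      using Cons.prems j by (intro Cons.IH) auto
    moreover have "w j x \<in> S j"
      using Cons.prems(1)[of j] j Cons.prems(5) by (simp add: permutes_in_image)
    then have "w j x \<notin> S i"
      using Cons.prems(2)[of i j] j False by auto
    then have "w i (w j x) = w j x"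
      using Cons.prems(1)[of i] by (simp add: permutes_not_in)
    ultimately show ?thesis by (simp add: comp_def[abs_def] id_def)
  qed
qed simp

section \<open>Cayley graphs and Cayley maps of cyclic groups\<close>

text \<open>Vertices are named by all integers, with period \<open>v\<close>, so that sums of a
  position and a difference need no reduction. Differences are reduced residues, so each arc has
  exactly one in \<open>S\<close>.\<close>

locale cyclic_cayley_graph =
  fixes K :: "'a pair_pre_digraph" and v :: nat and S :: "int set" and vtx :: "int \<Rightarrow> 'a"
  assumes v_pos: "v > 0"
    and vtx_eq_iff: "vtx x = vtx y \<longleftrightarrow> x mod int v = y mod int v"
    and pverts_eq: "pverts K = range vtx"
    and parcs_eq: "parcs K = {(vtx x, vtx (x + a)) | x a. a \<in> S}"
    and S_subset: "S \<subseteq> {0..<int v}"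
    and neg_S: "a \<in> S \<Longrightarrow> (- a) mod int v \<in> S"
begin

definition dart :: "int \<Rightarrow> int \<Rightarrow> 'a \<times> 'a" where
  "dart x a = (vtx x, vtx (x + a))"

definition residue :: "'a \<Rightarrow> int" where
  "residue p = (THE x. x \<in> {0..<int v} \<and> vtx x = p)"

text \<open>This is the invariant of an arc under translations: two arcs have the same label iff a
  translation carries one to the other.\<close>

definition label :: "'a \<times> 'a \<Rightarrow> int" where
  "label d = (residue (snd d) - residue (fst d)) mod int v"

lemma S_mod: "a \<in> S \<Longrightarrow> a mod int v = a"
  using S_subset by auto

lemma residue_vtx [simp]: "residue (vtx x) = x mod int v"
  unfolding residue_def
  by (rule the_equality) (use v_pos in \<open>auto simp: vtx_eq_iff\<close>)

lemma vtx_mod [simp]: "vtx (x mod int v) = vtx x"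
  by (simp add: vtx_eq_iff)

lemma vtx_mod_add [simp]: "vtx (x mod int v + y) = vtx (x + y)"
  by (simp add: vtx_eq_iff mod_add_left_eq)

lemma vtx_add_mod [simp]: "vtx (x + y mod int v) = vtx (x + y)"
  by (simp add: vtx_eq_iff mod_add_right_eq)

lemma label_dart [simp]: "label (dart x a) = a mod int v"
  by (simp add: label_def dart_def mod_diff_eq)

lemma dart_eq_iff: "dart x a = dart y b \<longleftrightarrow> x mod int v = y mod int v \<and> a mod int v = b mod int v"
proof
  assume "dart x a = dart y b"
  then show "x mod int v = y mod int v \<and> a mod int v = b mod int v"
    by (metis dart_def label_dart prod.inject residue_vtx)
next
  assume "x mod int v = y mod int v \<and> a mod int v = b mod int v"
  then show "dart x a = dart y b"
    by (simp add: dart_def vtx_eq_iff) (metis mod_add_cong)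
qed

lemma dart_in_parcs [simp]: "a \<in> S \<Longrightarrow> dart x a \<in> parcs K"
  by (auto simp: parcs_eq dart_def)

lemma parcsE:
  assumes "d \<in> parcs K"
  obtains x a where "a \<in> S" "d = dart x a"
  using assms by (auto simp: parcs_eq dart_def)

lemma label_in_S: "d \<in> parcs K \<Longrightarrow> label d \<in> S"
  by (auto elim!: parcsE simp: S_mod)

lemma swap_dart: "prod.swap (dart x a) = dart (x + a) ((- a) mod int v)"
  by (simp add: dart_def)

lemma label_swap: "d \<in> parcs K \<Longrightarrow> label (prod.swap d) = (- label d) mod int v"
  by (auto elim!: parcsE simp: swap_dart S_mod)

lemma swap_in_parcs: "d \<in> parcs K \<Longrightarrow> prod.swap d \<in> parcs K"
  by (auto elim!: parcsE simp: swap_dart neg_S)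

lemma finite_pverts: "finite (pverts K)"
proof -
  have "pverts K \<subseteq> vtx ` {0..<int v}"
    unfolding pverts_eq
  proof
    fix p assume "p \<in> range vtx"
    then obtain x where "p = vtx (x mod int v)" by auto
    then show "p \<in> vtx ` {0..<int v}"
      using v_pos by (intro image_eqI[where x = "x mod int v"]) auto
  qed
  then show ?thesis by (rule finite_subset) simp
qed

lemma parcs_subset: "parcs K \<subseteq> pverts K \<times> pverts K"
  by (auto simp: parcs_eq pverts_eq)

lemma finite_parcs: "finite (parcs K)"
  using finite_subset[OF parcs_subset] finite_pverts by simp

text \<open>The restriction to \<open>pverts K\<close> is there because members of
  \<open>Bij\<close> are extensional.\<close>

definition translation :: "int \<Rightarrow> 'a \<Rightarrow> 'a" where
  "translation c = (\<lambda>p\<in>pverts K. vtx (residue p + c))"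

lemma translation_vtx [simp]: "translation c (vtx x) = vtx (x + c)"
  by (simp add: translation_def pverts_eq)

lemma translation_extensional: "translation c \<in> extensional (pverts K)"
  by (simp add: translation_def)

lemma translation_Bij: "translation c \<in> Bij (pverts K)"
proof -
  have "bij_betw (translation c) (pverts K) (pverts K)"
    by (rule bij_betwI[where g = "translation (- c)"]) (auto simp: pverts_eq)
  then show ?thesis
    by (simp add: Bij_def translation_extensional)
qed

lemma translation_eqI:
  assumes "f \<in> extensional (pverts K)" "\<And>x. f (vtx x) = vtx (x + c)"
  shows "f = translation c"
  by (rule extensionalityI[OF assms(1) translation_extensional])
    (auto simp: pverts_eq assms(2))

lemma compose_translation: "compose (pverts K) (translation a) (translation b) = translation (a + b)"
  by (rule translation_eqI) (auto simp: compose_def pverts_eq ac_simps)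

lemma translation_mod [simp]: "translation (a mod int v) = translation a"
  by (rule translation_eqI) (auto simp: translation_extensional)

lemma translation_0: "translation 0 = (\<lambda>p\<in>pverts K. p)"
  by (rule sym, rule translation_eqI) (auto simp: pverts_eq)

lemma translation_parcs:
  assumes "x \<in> pverts K" "y \<in> pverts K"
  shows "(x, y) \<in> parcs K \<longleftrightarrow> (translation c x, translation c y) \<in> parcs K"
proof -
  have fwd: "(translation c x, translation c y) \<in> parcs K" if xy: "(x, y) \<in> parcs K" for x y c
  proof -
    obtain z a where "a \<in> S" "(x, y) = dart z a"
      using xy by (rule parcsE)
    then have "(translation c x, translation c y) = dart (z + c) a"
      by (simp add: dart_def algebra_simps)
    then show ?thesis using \<open>a \<in> S\<close> by simp
  qed
  obtain i j where "x = vtx i" "y = vtx j"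
    using assms by (auto simp: pverts_eq)
  \<comment> \<open>The converse is the forward direction for the shift by
    \<open>- c\<close>.\<close>
  then show ?thesis
    using fwd[of x y c] fwd[of "translation c x" "translation c y" "- c"] by auto
qed

end

text \<open>A Cayley map: one cyclic order of the generators, used at every vertex.\<close>

locale cyclic_cayley_map = cyclic_cayley_graph +
  fixes r :: "int \<Rightarrow> int"
  assumes r_cyclic: "cyclic_ordering r S"
begin

definition map_rotation :: "'a \<times> 'a \<Rightarrow> 'a \<times> 'a" where
  "map_rotation d = (if d \<in> parcs K then dart (residue (fst d)) (r (label d)) else d)"

abbreviation face_map :: "'a \<times> 'a \<Rightarrow> 'a \<times> 'a" where
  "face_map \<equiv> face_step map_rotation"

text \<open>The face map seen on labels: reversal negates, then the rotation applies
  \<open>r\<close>. No vertex enters, so faces can be studied on \<open>S\<close> alone.\<close>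

definition label_step :: "int \<Rightarrow> int" where
  "label_step a = r ((- a) mod int v)"

lemma r_permutes: "r permutes S"
  using r_cyclic by (simp add: cyclic_ordering_def)

lemma r_in_S: "a \<in> S \<Longrightarrow> r a \<in> S"
  using r_permutes by (simp add: permutes_in_image)

lemma label_step_in_S: "a \<in> S \<Longrightarrow> label_step a \<in> S"
  by (simp add: label_step_def r_in_S neg_S)

lemma map_rotation_dart [simp]:
  assumes "a \<in> S"
  shows "map_rotation (dart x a) = dart x (r a)"
proof -
  have "residue (fst (dart x a)) = x mod int v"
    by (simp add: dart_def)
  then show ?thesis
    using assms by (simp add: map_rotation_def S_mod dart_eq_iff)
qed

lemma face_map_swap: "face_map d = map_rotation (prod.swap d)"
  by (cases d) (simp add: face_step_def)

lemma face_map_dart [simp]: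
  assumes "a \<in> S"
  shows "face_map (dart x a) = dart (x + a) (label_step a)"
  using assms by (simp add: face_map_swap swap_dart neg_S label_step_def)

lemma map_rotation_permutes: "map_rotation permutes parcs K"
proof (rule bij_imp_permutes)
  have img: "map_rotation ` parcs K \<subseteq> parcs K"
    by (auto elim!: parcsE simp: r_in_S)
  have inj: "inj_on map_rotation (parcs K)"
  proof (rule inj_onI)
    fix d e assume de: "d \<in> parcs K" "e \<in> parcs K" and eq: "map_rotation d = map_rotation e"
    obtain x a where d: "a \<in> S" "d = dart x a" using de(1) by (rule parcsE)
    obtain y b where e: "b \<in> S" "e = dart y b" using de(2) by (rule parcsE)
    have "x mod int v = y mod int v" "r a = r b"
      using eq d e by (simp_all add: dart_eq_iff S_mod r_in_S)
    moreover from this have "a = b"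
      using permutes_inj[OF r_permutes] by (simp add: inj_eq)
    ultimately show "d = e"
      using d e by (simp add: dart_eq_iff)
  qed
  show "bij_betw map_rotation (parcs K) (parcs K)"
    using endo_inj_surj[OF finite_parcs img inj] inj by (simp add: bij_betw_def)
qed (simp add: map_rotation_def)

lemma rotation_map_rotation: "rotation K map_rotation"
  unfolding rotation_def
proof (intro conjI map_rotation_permutes exI ballI)
  fix p assume p: "p \<in> pverts K"
  then obtain i where i: "p = vtx i" by (auto simp: pverts_eq)
  let ?rp = "\<lambda>y. snd (map_rotation (p, y))"
  let ?nb = "(\<lambda>a. vtx (i + a)) ` S"
  have dart_p: "(p, vtx (i + a)) = dart i a" for a
    by (simp add: dart_def i)
  have nb: "neighbours K p = ?nb"
  proof (intro equalityI subsetI)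
    fix y assume "y \<in> neighbours K p"
    then have "(p, y) \<in> parcs K" by (simp add: neighbours_def)
    then obtain x a where xa: "a \<in> S" "(p, y) = dart x a" by (rule parcsE)
    \<comment> \<open>The tail fixes \<open>x\<close> only modulo \<open>v\<close>, so
      \<open>x\<close> and \<open>i\<close> need not be equal.\<close>
    then have "dart x a = dart i a"
      by (auto simp: dart_def i vtx_eq_iff intro: mod_add_cong)
    then have "y = vtx (i + a)"
      using xa by (simp add: dart_def)
    then show "y \<in> ?nb" using xa by blast
  qed (auto simp: neighbours_def dart_p)
  have rp: "?rp (vtx (i + a)) = vtx (i + r a)" if "a \<in> S" for a
    using that by (simp add: dart_p) (simp add: dart_def)
  \<comment> \<open>The map sending \<open>a\<close> to \<open>vtx (i + a)\<close> intertwines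
    \<open>r\<close> with the local rotation, so the single cycle is inherited.\<close>
  have cyc: "cyclic_on ?rp ?nb"
    by (rule cyclic_on_image) (use r_cyclic rp in \<open>auto simp: cyclic_ordering_def\<close>)
  have "?rp permutes ?nb"
  proof (rule bij_imp_permutes)
    have img: "?rp ` ?nb \<subseteq> ?nb"
      using rp r_in_S by auto
    have "inj_on ?rp ?nb"
    proof (rule inj_onI)
      fix y z assume yz: "y \<in> ?nb" "z \<in> ?nb" "?rp y = ?rp z"
      then obtain a b where ab: "a \<in> S" "b \<in> S" "y = vtx (i + a)" "z = vtx (i + b)"
        by blast
      then have "dart i (r a) = dart i (r b)"
        using yz(3) rp by (simp add: dart_def)
      then have "r a = r b"
        using ab r_in_S by (simp add: dart_eq_iff S_mod)
      then show "y = z"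
        using permutes_inj[OF r_permutes] ab by (simp add: inj_eq)
    qed
    moreover have "finite ?nb"
      using finite_subset[OF S_subset] by simp
    ultimately show "bij_betw ?rp ?nb ?nb"
      using endo_inj_surj[OF _ img] by (simp add: bij_betw_def)
  next
    fix y assume "y \<notin> ?nb"
    then have "(p, y) \<notin> parcs K"
      using nb by (auto simp: neighbours_def)
    then show "?rp y = y"
      by (simp add: map_rotation_def)
  qed
  with cyc show "cyclic_ordering ?rp (neighbours K p)"
    by (simp add: cyclic_ordering_def nb)
  fix y assume "y \<in> neighbours K p"
  then obtain a where "a \<in> S" "y = vtx (i + a)" unfolding nb by blast
  then show "map_rotation (p, y) = (p, ?rp y)"
    by (simp add: dart_p) (simp add: dart_def i)
qed

section \<open>Faces and the labels along them\<close>

lemma face_map_in_parcs: "d \<in> parcs K \<Longrightarrow> face_map d \<in> parcs K"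
  by (auto elim!: parcsE simp: label_step_in_S)

lemma self_in_face:
  assumes "d \<in> parcs K"
  shows "d \<in> orbit face_map d"
proof (rule inj_on_self_in_orbit[OF finite_parcs _ _ assms])
  show "inj_on face_map (parcs K)"
    using permutes_inj[OF map_rotation_permutes]
    by (auto simp: face_map_swap inj_def intro!: inj_onI)
qed (use face_map_in_parcs in blast)

lemma label_face_map:
  assumes "d \<in> parcs K"
  shows "label (face_map d) = label_step (label d)"
  using assms by (auto elim!: parcsE simp: S_mod label_step_in_S)

lemma face_subset_parcs:
  assumes "d \<in> parcs K"
  shows "orbit face_map d \<subseteq> parcs K"
proof
  fix e assume "e \<in> orbit face_map d"
  then show "e \<in> parcs K"
    by induction (auto intro: face_map_in_parcs assms)
qed

lemma funpow_face_map:
  assumes "d \<in> parcs K"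
  shows "(face_map ^^ i) d \<in> parcs K" "label ((face_map ^^ i) d) = (label_step ^^ i) (label d)"
  by (induction i) (auto simp: assms face_map_in_parcs label_face_map)

text \<open>When a face closes, its label has returned as well, so the number of steps is a return
  time of the label cycle.\<close>

lemma face_length_dvd:
  assumes "d \<in> parcs K" "cyclic_on label_step C" "label d \<in> C"
  shows "card C dvd card (orbit face_map d)"
proof (rule card_cyclic_on_dvd[OF assms(2,3)])
  show "(label_step ^^ card (orbit face_map d)) (label d) = label d"
    using funpow_face_map(2)[OF assms(1), of "card (orbit face_map d)"]
      funpow_card_orbit[OF self_in_face[OF assms(1)]] by simp
qed

text \<open>This makes the colour of a face independent of the arc from which it is read.\<close>

lemma face_label_invariant:
  assumes "d \<in> parcs K" "e \<in> orbit face_map d"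
    and "\<And>a. a \<in> S \<Longrightarrow> label_step a \<in> E \<longleftrightarrow> a \<in> E"
  shows "label e \<in> E \<longleftrightarrow> label d \<in> E"
  using assms(2)
proof induction
  case (step e)
  then have "e \<in> parcs K" using face_subset_parcs[OF assms(1)] by blast
  with step show ?case by (simp add: label_face_map assms(3) label_in_S)
qed (simp add: label_face_map assms(1,3) label_in_S)

text \<open>Faces are coloured by whether their darts have labels in \<open>E\<close>.\<close>

lemma biembeddingI:
  assumes cell: "cellular_embedding K map_rotation"
    and step: "\<And>a. a \<in> S \<Longrightarrow> label_step a \<in> E \<longleftrightarrow> a \<in> E"
    and neg: "\<And>a. a \<in> S \<Longrightarrow> (- a) mod int v \<in> E \<longleftrightarrow> a \<notin> E"
  shows "biembedding K map_rotation"
  unfolding biembedding_def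
proof (intro conjI cell exI ballI allI)
  let ?colour = "\<lambda>F. \<exists>d\<in>F. label d \<in> E"
  have colour: "?colour (orbit face_map d) \<longleftrightarrow> label d \<in> E" if "d \<in> parcs K" for d
    using face_label_invariant[OF that _ step] self_in_face[OF that] by blast
  fix e c assume e: "e \<in> parcs K"
  \<comment> \<open>By \<open>neg\<close>, exactly one orientation of the edge has a label on the
    side of \<open>E\<close> asked for by \<open>c\<close>.\<close>
  obtain d where d: "d = e \<or> d = prod.swap e" "label d \<in> E \<longleftrightarrow> c"
    using label_swap[OF e] neg[OF label_in_S[OF e]] by metis
  have dK: "d \<in> parcs K"
    using d(1) e swap_in_parcs by blast
  have other: "label (prod.swap d) \<in> E \<longleftrightarrow> \<not> c"
    using label_swap[OF dK] neg[OF label_in_S[OF dK]] d(2) by simp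
  have on: "edge_on_face e F \<longleftrightarrow> d \<in> F \<or> prod.swap d \<in> F" for F
    using d(1) by (auto simp: edge_on_face_def)
  show "\<exists>!F. F \<in> faces K map_rotation \<and> edge_on_face e F \<and> ?colour F = c"
  proof (intro ex1I[where a = "orbit face_map d"] conjI)
    show "orbit face_map d \<in> faces K map_rotation"
      using dK by (simp add: faces_def)
    show "edge_on_face e (orbit face_map d)"
      using self_in_face[OF dK] by (simp add: on)
    show "?colour (orbit face_map d) = c"
      by (simp add: colour dK d(2))
  next
    fix F assume F: "F \<in> faces K map_rotation \<and> edge_on_face e F \<and> ?colour F = c"
    then obtain f where f: "f \<in> parcs K" "F = orbit face_map f"
      by (auto simp: faces_def)
    \<comment> \<open>The reverse orientation has the other colour, so \<open>F\<close> meets the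
      edge in \<open>d\<close>, and a face is determined by any of its arcs.\<close>
    have "\<not> prod.swap d \<in> F"
      using face_label_invariant[OF f(1) _ step] colour[OF f(1)] other F f(2) by blast
    then have "d \<in> orbit face_map f"
      using F f(2) on by blast
    then show "F = orbit face_map d"
      using orbit_eq_of_mem[OF self_in_face[OF f(1)]] f(2) by simp
  qed
qed

section \<open>Translations as automorphisms of the embedding\<close>

lemma funpow_face_map_translation:
  assumes "d \<in> parcs K"
  shows "(face_map ^^ i) (map_prod (translation c) (translation c) d)
    = map_prod (translation c) (translation c) ((face_map ^^ i) d)"
proof (induction i)
  case (Suc i)
  obtain x a where xa: "a \<in> S" "(face_map ^^ i) d = dart x a"
    using funpow_face_map(1)[OF assms] by (rule parcsE)
  have tr: "map_prod (translation c) (translation c) (dart y b) = dart (y + c) b" for y b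
    by (simp add: dart_def algebra_simps)
  \<comment> \<open>Neither the displacement nor the new label depends on the vertex, so a shift by
    \<open>c\<close> passes through the face map.\<close>
  show ?case
    using Suc xa by (simp add: tr algebra_simps)
qed simp

lemma boundary_walk_translation:
  assumes "d \<in> parcs K"
  shows "boundary_walk map_rotation (map_prod (translation c) (translation c) d)
    = map (translation c) (boundary_walk map_rotation d)"
proof -
  let ?T = "map_prod (translation c) (translation c)"
  have "orbit face_map (?T d) = ?T ` orbit face_map d"
    unfolding orbit_altdef funpow_face_map_translation[OF assms]
    by (simp only: setcompr_eq_image image_image)
  \<comment> \<open>A boundary walk is as long as its orbit is large, so equal lengths require
    injectivity.\<close>
  moreover have "inj_on (translation c) (pverts K)"
    using translation_Bij by (auto simp: Bij_def bij_betw_def)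
  then have "inj_on ?T (pverts K \<times> pverts K)"
    using map_prod_inj_on by blast
  then have "inj_on ?T (orbit face_map d)"
    by (rule inj_on_subset) (use face_subset_parcs[OF assms] parcs_subset in blast)
  ultimately have "card (orbit face_map (?T d)) = card (orbit face_map d)"
    by (simp add: card_image)
  then show ?thesis
    by (simp add: boundary_walk_def funpow_face_map_translation[OF assms])
qed

lemma translation_image_boundary_walks:
  "map (translation c) ` boundary_walks K map_rotation = boundary_walks K map_rotation"
proof -
  let ?T = "map_prod (translation c) (translation c)"
  have T: "?T ` parcs K = parcs K"
  proof (intro equalityI subsetI)
    fix d assume "d \<in> ?T ` parcs K"
    then obtain p p' where p: "(p, p') \<in> parcs K" "d = (translation c p, translation c p')"
      by auto
    then have "p \<in> pverts K" "p' \<in> pverts K"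
      using parcs_subset by auto
    then show "d \<in> parcs K"
      using translation_parcs[THEN iffD1] p by simp
  next
    fix d assume "d \<in> parcs K"
    then obtain x a where xa: "a \<in> S" "d = dart x a" by (rule parcsE)
    then have "d = ?T (dart (x - c) a)"
      by (simp add: dart_def algebra_simps)
    then show "d \<in> ?T ` parcs K" by (rule image_eqI) (simp add: xa)
  qed
  have "map (translation c) ` boundary_walk map_rotation ` parcs K
      = boundary_walk map_rotation ` ?T ` parcs K"
    unfolding image_image by (rule image_cong) (simp_all add: boundary_walk_translation)
  then have *: "map (translation c) ` boundary_walk map_rotation ` parcs K
      = boundary_walk map_rotation ` parcs K"
    by (simp add: T)
  have "map (translation c) ` rev ` boundary_walk map_rotation ` parcs K
      = rev ` map (translation c) ` boundary_walk map_rotation ` parcs K"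
    by (simp only: image_image rev_map)
  then show ?thesis
    by (simp only: boundary_walks_def image_Un *)
qed

lemma translation_automorphism:
  "translation c \<in> embedding_automorphisms K map_rotation"
  using translation_Bij translation_parcs translation_image_boundary_walks
  unfolding embedding_automorphisms_def by blast

lemma cyclic_regular_map: "cyclic_regular v K map_rotation"
  unfolding cyclic_regular_def
proof (intro exI conjI ballI)
  let ?G = "embedding_aut_group K map_rotation"
  let ?H = "range translation"
  have mult: "translation a \<otimes>\<^bsub>?G\<^esub> translation b = translation (a + b)" for a b
    by (simp add: embedding_aut_group_def BijGroup_def translation_Bij compose_translation)
  have one: "\<one>\<^bsub>?G\<^esub> = translation 0"
    by (simp add: embedding_aut_group_def BijGroup_def translation_0)
  have carrier: "carrier ?G = embedding_automorphisms K map_rotation"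
    by (simp add: embedding_aut_group_def)
  \<comment> \<open>The group axioms for \<open>?G\<close> have not been established, so the inverse
    is computed from its definite description.\<close>
  have inv: "inv\<^bsub>?G\<^esub> (translation a) = translation (- a)" for a
    unfolding m_inv_def
  proof (rule the_equality)
    fix f assume f: "f \<in> carrier ?G \<and> translation a \<otimes>\<^bsub>?G\<^esub> f = \<one>\<^bsub>?G\<^esub>
      \<and> f \<otimes>\<^bsub>?G\<^esub> translation a = \<one>\<^bsub>?G\<^esub>"
    then have "f \<in> Bij (pverts K)"
      by (simp add: carrier embedding_automorphisms_def)
    moreover from this f have comp: "compose (pverts K) f (translation a) = translation 0"
      by (simp add: one embedding_aut_group_def BijGroup_def translation_Bij translation_0)
    have "f (vtx x) = vtx (x + - a)" for x
      using fun_cong[OF comp, of "vtx (x - a)"] by (simp add: compose_def pverts_eq)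
    ultimately show "f = translation (- a)"
      by (intro translation_eqI) (auto dest: Bij_imp_extensional)
  qed (simp_all add: mult one carrier translation_automorphism)
  show "subgroup ?H ?G"
    by (rule subgroup.intro) (auto simp: mult one inv carrier translation_automorphism)
  \<comment> \<open>The isomorphism starts from \<open>integer_mod_group v\<close>, already known to
    be a group; this is what \<open>iso_sym\<close> requires to invert it.\<close>
  have "translation \<in> iso (integer_mod_group v) (?G\<lparr>carrier := ?H\<rparr>)"
    unfolding iso_def
  proof (intro CollectI conjI)
    show "translation \<in> hom (integer_mod_group v) (?G\<lparr>carrier := ?H\<rparr>)"
      by (rule homI) (auto simp: mult)
    have "inj_on translation {0..<int v}"
    proof (rule inj_onI)
      fix a b assume ab: "a \<in> {0..<int v}" "b \<in> {0..<int v}" "translation a = translation b"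
      have "vtx (0 + a) = vtx (0 + b)"
        using fun_cong[OF ab(3), of "vtx 0"] unfolding translation_vtx .
      then show "a = b" using ab(1,2) by (simp add: vtx_eq_iff)
    qed
    moreover have "translation ` {0..<int v} = ?H"
    proof (intro equalityI subsetI)
      fix f assume "f \<in> ?H"
      then obtain a where "f = translation (a mod int v)" by auto
      then show "f \<in> translation ` {0..<int v}"
        using v_pos by (intro image_eqI[where x = "a mod int v"]) auto
    qed auto
    ultimately show "bij_betw translation (carrier (integer_mod_group v))
        (carrier (?G\<lparr>carrier := ?H\<rparr>))"
      using v_pos by (simp add: bij_betw_def carrier_integer_mod_group)
  qed
  then show "?G\<lparr>carrier := ?H\<rparr> \<cong> integer_mod_group v"
    by (intro group.iso_sym[OF group_integer_mod_group]) (auto simp: is_iso_def)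
  fix p p' assume "p \<in> pverts K" "p' \<in> pverts K"
  then obtain x y where xy: "p = vtx x" "p' = vtx y" by (auto simp: pverts_eq)
  show "\<exists>!\<sigma>. \<sigma> \<in> ?H \<and> \<sigma> p = p'"
  proof (rule ex1I[where a = "translation (y - x)"])
    fix \<sigma> assume "\<sigma> \<in> ?H \<and> \<sigma> p = p'"
    then obtain c where c: "\<sigma> = translation c" "vtx (x + c) = vtx y"
      using xy by auto
    \<comment> \<open>The images of one vertex determine \<open>c\<close> only modulo
      \<open>v\<close>, which is all that \<open>translation c\<close> depends on.\<close>
    then have "c mod int v = (y - x) mod int v"
      using mod_diff_cong[of "x + c" "int v" y x x] by (simp add: vtx_eq_iff)
    then show "\<sigma> = translation (y - x)"
      using c(1) translation_mod by metis
  qed (simp add: xy)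
qed

end

section \<open>Complete multipartite graphs\<close>

lemma pair_graph_complete_multipartite: "pair_graph (complete_multipartite q t)"
proof -
  have "finite (parcs (complete_multipartite q t))"
    by (rule finite_subset[of _ "({..<q} \<times> {..<t}) \<times> ({..<q} \<times> {..<t})"])
      (auto simp: complete_multipartite_def)
  then show ?thesis
    by unfold_locales
      (auto simp: complete_multipartite_def symmetric_def arcs_ends_conv sym_def)
qed

lemma connected_complete_multipartite:
  assumes "q \<ge> 2" "t > 0"
  shows "Digraph_Component.connected (with_proj (complete_multipartite q t))"
proof -
  let ?K = "complete_multipartite q t"
  let ?R = "rtrancl_on (pverts ?K) ((parcs ?K)\<^sup>s)"
  have adj: "(x, y) \<in> (parcs ?K)\<^sup>s" if "x \<in> pverts ?K" "y \<in> pverts ?K" "fst x \<noteq> fst y" for x y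
    using that by (auto simp: complete_multipartite_def symcl_def)
  have "(x, y) \<in> ?R" if xy: "x \<in> pverts ?K" "y \<in> pverts ?K" for x y
  proof (cases "fst x = fst y")
    case False
    then show ?thesis
      using adj xy by (meson rtrancl_on_refl rtrancl_on_into_rtrancl_on)
  next
    case True
    \<comment> \<open>A vertex outside the common part of \<open>x\<close> and \<open>y\<close>,
      hence adjacent to both; it exists because \<open>q \<ge> 2\<close>.\<close>
    define z where "z = (if fst x = 0 then 1 else 0 :: nat, 0 :: nat)"
    have z: "z \<in> pverts ?K" "fst x \<noteq> fst z" "fst z \<noteq> fst y"
      using assms True by (auto simp: z_def complete_multipartite_def)
    then have "(x, z) \<in> ?R"
      using adj xy by (meson rtrancl_on_refl rtrancl_on_into_rtrancl_on)
    then show ?thesis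
      using adj[OF z(1) xy(2) z(3)] xy by (meson rtrancl_on_into_rtrancl_on)
  qed
  moreover have "pverts ?K \<noteq> {}"
    using assms by (auto simp: complete_multipartite_def lessThan_empty_iff)
  ultimately show ?thesis
    by (simp add: connected_conv)
qed

text \<open>
  The residue \<open>x\<close> modulo \<open>q * t\<close> becomes vertex number \<open>x div q\<close> of part \<open>x mod q\<close>, so that the
  parts are the cosets of the subgroup of multiples of \<open>q\<close>.
\<close>

definition multipartite_vertex :: "nat \<Rightarrow> nat \<Rightarrow> int \<Rightarrow> nat \<times> nat" where
  "multipartite_vertex q t x =
     (nat (x mod int (q * t)) mod q, nat (x mod int (q * t)) div q)"

lemma int_fst_multipartite_vertex:
  assumes "q > 0" "t > 0"
  shows "int (fst (multipartite_vertex q t x)) = x mod int q"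
proof -
  have "int (fst (multipartite_vertex q t x)) = (x mod int (q * t)) mod int q"
    using assms by (simp add: multipartite_vertex_def zmod_int)
  also have "\<dots> = x mod int q"
    by (simp add: mod_mod_cancel)
  finally show ?thesis .
qed

lemma multipartite_vertex_eq_iff:
  assumes "q > 0" "t > 0"
  shows "multipartite_vertex q t x = multipartite_vertex q t y
    \<longleftrightarrow> x mod int (q * t) = y mod int (q * t)"
proof
  assume eq: "multipartite_vertex q t x = multipartite_vertex q t y"
  \<comment> \<open>Quotient and remainder by \<open>q\<close> recover the residue.\<close>
  have rec: "x mod int (q * t) = int (q * snd (multipartite_vertex q t x)
      + fst (multipartite_vertex q t x))" for x
    using assms by (simp only: multipartite_vertex_def fst_conv snd_conv mult_div_mod_eq) simp
  show "x mod int (q * t) = y mod int (q * t)"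
    using rec[of x] rec[of y] eq by simp
qed (simp add: multipartite_vertex_def)

lemma range_multipartite_vertex:
  assumes "q > 0" "t > 0"
  shows "range (multipartite_vertex q t) = {..<q} \<times> {..<t}"
proof (intro equalityI subsetI)
  fix p assume "p \<in> range (multipartite_vertex q t)"
  then obtain x where p: "p = multipartite_vertex q t x" by blast
  have "nat (x mod int (q * t)) < q * t"
    using assms by (simp add: nat_less_iff)
  then have "nat (x mod int (q * t)) div q < t"
    by (simp add: less_mult_imp_div_less mult.commute)
  then show "p \<in> {..<q} \<times> {..<t}"
    using assms by (simp add: p multipartite_vertex_def)
next
  fix p assume "p \<in> {..<q} \<times> {..<t}"
  then obtain a b where p: "p = (a, b)" "a < q" "b < t" by blast
  have "q * b + a < q * (b + 1)" using p by simp
  also have "\<dots> \<le> q * t" using p by (intro mult_le_mono2) simp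
  finally have "int (q * b + a) mod int (q * t) = int (q * b + a)"
    by (metis mod_less of_nat_mod)
  then have "multipartite_vertex q t (int (q * b + a)) = p"
    using p assms by (simp only: multipartite_vertex_def nat_int) simp
  then show "p \<in> range (multipartite_vertex q t)" by blast
qed

text \<open>The part of a vertex is its residue modulo \<open>q\<close>, so adjacency means that
  \<open>q\<close> does not divide the difference.\<close>

lemma cyclic_cayley_graph_complete_multipartite:
  assumes "q > 0" "t > 0"
  shows "cyclic_cayley_graph (complete_multipartite q t) (q * t)
    {a \<in> {0..<int (q * t)}. \<not> int q dvd a} (multipartite_vertex q t)"
    (is "cyclic_cayley_graph ?K ?v ?S ?V")
proof
  note eq_iff = multipartite_vertex_eq_iff[OF assms]
  note rng = range_multipartite_vertex[OF assms]
  have q_dvd: "int q dvd a mod int ?v \<longleftrightarrow> int q dvd a" for a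
    by (simp add: dvd_mod_iff)
  show v_pos: "?v > 0" using assms by simp
  show "?V x = ?V y \<longleftrightarrow> x mod int ?v = y mod int ?v" for x y
    by (rule eq_iff)
  show "pverts ?K = range ?V"
    by (simp add: complete_multipartite_def rng)
  have arc: "(?V x, ?V y) \<in> parcs ?K \<longleftrightarrow> \<not> int q dvd y - x" for x y
  proof -
    have "?V x \<in> {..<q} \<times> {..<t}" "?V y \<in> {..<q} \<times> {..<t}"
      using rng by blast+
    moreover have "fst (?V x) = fst (?V y) \<longleftrightarrow> int q dvd y - x"
      by (metis int_fst_multipartite_vertex[OF assms] mod_eq_dvd_iff of_nat_eq_iff)
    ultimately show ?thesis
      by (simp add: complete_multipartite_def)
  qed
  show "parcs ?K = {(?V x, ?V (x + a)) | x a. a \<in> ?S}"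
  proof (intro equalityI subsetI)
    fix d assume d: "d \<in> parcs ?K"
    then have "fst d \<in> range ?V" "snd d \<in> range ?V"
      unfolding rng by (auto simp: complete_multipartite_def)
    then obtain x y where xy: "d = (?V x, ?V y)"
      by (metis rangeE surjective_pairing)
    let ?a = "(y - x) mod int ?v"
    have "?V (x + ?a) = ?V y"
      by (simp add: eq_iff mod_add_right_eq)
    moreover have "?a \<in> ?S"
      using arc d xy q_dvd v_pos by simp
    ultimately show "d \<in> {(?V x, ?V (x + a)) | x a. a \<in> ?S}"
      unfolding xy by (intro CollectI exI[of _ x] exI[of _ ?a]) simp
  qed (auto simp: arc)
  show "?S \<subseteq> {0..<int ?v}" by blast
  show "(- a) mod int ?v \<in> ?S" if "a \<in> ?S" for a
    using that v_pos q_dvd[of "- a"] by simp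
qed

section \<open>Quasi-Heffter arrays\<close>

lemma card_multiples:
  assumes "q > 0" "t > 0"
  shows "card {a \<in> {0..<int (q * t)}. int q dvd a} = t"
proof -
  have "{a \<in> {0..<int (q * t)}. int q dvd a} = (\<lambda>b. int q * int b) ` {..<t}"
  proof (intro equalityI subsetI)
    fix a assume a: "a \<in> {a \<in> {0..<int (q * t)}. int q dvd a}"
    then obtain b where b: "a = int q * b" by blast
    then have "0 \<le> b" "b < int t"
      using a assms by (auto simp: zero_le_mult_iff)
    then show "a \<in> (\<lambda>b. int q * int b) ` {..<t}"
      using b by (intro image_eqI[where x = "nat b"]) auto
  qed (use assms in auto)
  moreover have "inj_on (\<lambda>b. int q * int b) {..<t}"
    using assms by (auto intro: inj_onI)
  ultimately show ?thesis
    by (simp add: card_image)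
qed

lemma multiples_subgroup_eq:
  assumes "q > 0" "t > 0"
  shows "multiples_subgroup (q * t) t = {a \<in> {0..<int (q * t)}. int q dvd a}"
proof -
  have v: "q * t div t = q" "0 < int (q * t)" using assms by auto
  show ?thesis
  proof (intro equalityI subsetI)
    fix a assume "a \<in> multiples_subgroup (q * t) t"
    then obtain x where "a = (int q * x) mod int (q * t)"
      unfolding multiples_subgroup_def v(1) by blast
    moreover have "int q dvd (int q * x) mod int (q * t)"
      by (simp add: dvd_mod_iff)
    moreover have "(int q * x) mod int (q * t) \<in> {0..<int (q * t)}"
      using v(2) by (simp del: of_nat_mult)
    ultimately show "a \<in> {a \<in> {0..<int (q * t)}. int q dvd a}"
      by blast
  next
    fix a assume a: "a \<in> {a \<in> {0..<int (q * t)}. int q dvd a}"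
    then obtain b where b: "a = int q * b" by blast
    \<comment> \<open>The quotient \<open>b\<close> does not exceed \<open>a\<close>, so it is
      itself a reduced residue and serves as preimage.\<close>
    have b_bounds: "0 \<le> b" "b \<le> a"
      using a b assms by (auto simp: zero_le_mult_iff mult_le_cancel_right1)
    have "b \<in> carrier (integer_mod_group (q * t))"
      using b_bounds a by (auto simp: carrier_integer_mod_group)
    moreover have "(int q * b) mod int (q * t) = a"
      using a b by simp
    ultimately show "a \<in> multiples_subgroup (q * t) t"
      unfolding multiples_subgroup_def v(1) by (intro image_eqI) auto
  qed
qed

lemma card_filled_cells:
  assumes "\<And>j. j < n \<Longrightarrow> card {i. i < m \<and> A i j \<noteq> None} = k"
  shows "card (filled_cells m n A) = n * k"
proof -
  have "filled_cells m n A = prod.swap ` (SIGMA j:{..<n}. {i. i < m \<and> A i j \<noteq> None})"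
    by (auto simp: filled_cells_def image_iff)
  then have "card (filled_cells m n A) = card (SIGMA j:{..<n}. {i. i < m \<and> A i j \<noteq> None})"
    by (simp add: card_image)
  also have "\<dots> = n * k"
    using assms by simp
  finally show ?thesis .
qed

text \<open>
  The \<open>2nk\<close> signed entries cover the \<open>2nk\<close> residues outside the subgroup, so no two of them coincide.
\<close>

lemma quasi_heffter_structure:
  assumes "quasi_heffter t m n h k A"
  defines "v \<equiv> 2 * n * k + t"
  defines "S \<equiv> {a \<in> {0..<int v}. \<not> int (v div t) dvd a}"
    and "E \<equiv> entries m n A" and "N \<equiv> (\<lambda>a. (- a) mod int v) ` entries m n A"
  shows "t > 0" "v = (v div t) * t" "v div t \<ge> 2"
    and "S = E \<union> N" "E \<inter> N = {}"
    and "inj_on (\<lambda>(i, j). the (A i j)) (filled_cells m n A)"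
proof -
  note qh = assms(1)[unfolded quasi_heffter_def Let_def, folded v_def]
  have nk: "n > 0" "k > 0" "t dvd 2 * n * k" using qh by auto
  then have nk0: "2 * n * k > 0" by simp
  show t: "t > 0" using nk(3) nk0 by (cases t) auto
  have "t dvd v" using nk(3) by (simp add: v_def)
  then show v: "v = (v div t) * t" by simp
  show q: "v div t \<ge> 2"
  proof (rule ccontr)
    assume "\<not> v div t \<ge> 2"
    then have "v \<le> 1 * t" using v by (metis mult_le_mono1 not_less_eq_eq numeral_2_eq_2 One_nat_def)
    then show False using nk0 by (simp add: v_def)
  qed
  define q where "q = v div t"
  have vq: "v = q * t" using v by (simp add: q_def)
  have q0: "q > 0" using q by (simp add: q_def)
  have v0: "v > 0" using t by (simp add: v_def)
  let ?C = "filled_cells m n A"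
  let ?f = "\<lambda>(i, j). the (A i j)"
  have finC: "finite ?C"
    by (rule finite_subset[of _ "{..<m} \<times> {..<n}"]) (auto simp: filled_cells_def)
  have cardC: "card ?C = n * k" using qh by (intro card_filled_cells) auto
  have EC: "E = ?f ` ?C"
    unfolding E_def entries_def filled_cells_def by (force simp: image_iff)
  have E_carrier: "E \<subseteq> carrier (integer_mod_group v)" using qh by (simp add: E_def)
  have J: "multiples_subgroup v t = {a \<in> {0..<int v}. int q dvd a}"
    using multiples_subgroup_eq[OF q0 t] by (simp add: vq)
  have S_eq: "S = carrier (integer_mod_group v) - multiples_subgroup v t"
    using v0 unfolding J by (auto simp: S_def carrier_integer_mod_group q_def)
  have "card S = card {0..<int v} - card {a \<in> {0..<int v}. int q dvd a}"
  proof -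
    have "{a \<in> {0..<int v}. int q dvd a} \<subseteq> {0..<int v}" by blast
    moreover from this have "finite {a \<in> {0..<int v}. int q dvd a}"
      by (rule finite_subset) simp
    ultimately show ?thesis
      using v0 unfolding S_eq J carrier_integer_mod_group by (simp add: card_Diff_subset)
  qed
  \<comment> \<open>This is \<open>v - t\<close>, the subgroup having order
    \<open>t\<close>.\<close>
  then have cardS: "card S = 2 * (n * k)"
    using card_multiples[OF q0 t] by (simp add: vq[symmetric]) (simp add: v_def)
  have SEN: "S \<subseteq> E \<union> N"
  proof
    fix x assume "x \<in> S"
    then have "count (pm_entries v m n A) x = 1"
      using qh by (simp add: S_eq)
    then have "x \<in># pm_entries v m n A"
      by (simp flip: count_greater_zero_iff)
    then obtain i j where ij: "(i, j) \<in> ?C"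
      and x: "x = the (A i j) \<or> x = inv\<^bsub>integer_mod_group v\<^esub> (the (A i j))"
      unfolding pm_entries_def set_mset_sum[OF finC] by auto
    have "the (A i j) \<in> E" using ij EC by force
    then show "x \<in> E \<union> N"
      using x E_carrier unfolding N_def E_def by auto
  qed
  have finE: "finite E" using EC finC by simp
  then have finN: "finite N" by (simp add: N_def E_def)
  have cE: "card E \<le> n * k" using card_image_le[OF finC, of ?f] cardC EC by simp
  have cN: "card N \<le> card E" unfolding N_def using card_image_le finE by (simp add: E_def)
  \<comment> \<open>The squeeze: \<open>2 * (n * k)\<close> is at most the size of the union, which
    is at most \<open>card E + card N\<close>, which is at most \<open>2 * (n * k)\<close>. Equality
    throughout gives disjointness, the value of \<open>S\<close> and distinct entries.\<close>
  have "card S \<le> card (E \<union> N)" using SEN finE finN by (intro card_mono) auto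
  moreover have un: "card E + card N = card (E \<union> N) + card (E \<inter> N)"
    using finE finN by (rule card_Un_Int)
  ultimately have eqs: "card E = n * k" "card (E \<union> N) = card S" "card (E \<inter> N) = 0"
    using cE cN cardS by auto
  then show "E \<inter> N = {}" using finE by simp
  show "S = E \<union> N" using card_subset_eq[OF _ SEN] finE finN eqs by simp
  show "inj_on ?f ?C"
    using eqs(1) cardC EC finC by (intro eq_card_imp_inj_on) auto
qed

text \<open>Since an entry determines its cell, replacing a line by its set of entries loses
  nothing.\<close>

lemma line_entries:
  assumes "inj_on (\<lambda>(i, j). the (A i j)) (filled_cells m n A)"
  shows "i < m \<Longrightarrow> card (row_entries n A i) = card {j. j < n \<and> A i j \<noteq> None}"
    and "j < n \<Longrightarrow> card (col_entries m A j) = card {i. i < m \<and> A i j \<noteq> None}"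
    and "\<lbrakk>i < m; i' < m; i \<noteq> i'\<rbrakk> \<Longrightarrow> row_entries n A i \<inter> row_entries n A i' = {}"
    and "\<lbrakk>j < n; j' < n; j \<noteq> j'\<rbrakk> \<Longrightarrow> col_entries m A j \<inter> col_entries m A j' = {}"
proof -
  have inj: "i = i' \<and> j = j'"
    if "A i j = Some x" "A i' j' = Some x" "i < m" "i' < m" "j < n" "j' < n" for i i' j j' x
    using inj_onD[OF assms, of "(i, j)" "(i', j')"] that by (simp add: filled_cells_def)
  show "card (row_entries n A i) = card {j. j < n \<and> A i j \<noteq> None}" if "i < m"
  proof -
    have "row_entries n A i = (\<lambda>j. the (A i j)) ` {j. j < n \<and> A i j \<noteq> None}"
      by (auto simp: row_entries_def intro!: rev_image_eqI)
    moreover have "inj_on (\<lambda>j. the (A i j)) {j. j < n \<and> A i j \<noteq> None}"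
      using that by (auto intro!: inj_onI dest: inj)
    ultimately show ?thesis by (simp add: card_image)
  qed
  show "card (col_entries m A j) = card {i. i < m \<and> A i j \<noteq> None}" if "j < n"
  proof -
    have "col_entries m A j = (\<lambda>i. the (A i j)) ` {i. i < m \<and> A i j \<noteq> None}"
      by (auto simp: col_entries_def intro!: rev_image_eqI)
    moreover have "inj_on (\<lambda>i. the (A i j)) {i. i < m \<and> A i j \<noteq> None}"
      using that by (auto intro!: inj_onI dest: inj)
    ultimately show ?thesis by (simp add: card_image)
  qed
  show "row_entries n A i \<inter> row_entries n A i' = {}" if "i < m" "i' < m" "i \<noteq> i'"
    using that by (auto simp: row_entries_def dest: inj)
  show "col_entries m A j \<inter> col_entries m A j' = {}" if "j < n" "j' < n" "j \<noteq> j'"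
    using that by (auto simp: col_entries_def dest: inj)
qed

text \<open>On its own block the product agrees with a single factor. Rows and columns thus become
  cycles of \<open>w_r\<close> and \<open>w_c\<close>, and these cycles supply the divisors of the
  face lengths.\<close>

lemma cyclic_on_foldr_comp:
  fixes w :: "nat \<Rightarrow> 'a \<Rightarrow> 'a"
  assumes "\<And>i. i < l \<Longrightarrow> cyclic_ordering (w i) (C i)"
    and "\<And>i j. i < l \<Longrightarrow> j < l \<Longrightarrow> i \<noteq> j \<Longrightarrow> C i \<inter> C j = {}" and "i < l"
  shows "cyclic_on (foldr (\<circ>) (map w [0..<l]) id) (C i)"
proof -
  have "foldr (\<circ>) (map w [0..<l]) id x = w i x" if "x \<in> C i" for x
    using assms that by (intro foldr_comp_apply[where S = C]) (auto simp: cyclic_ordering_def)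
  then show ?thesis
    using assms(1)[OF assms(3)] cyclic_cong[of "C i" "foldr (\<circ>) (map w [0..<l]) id" "w i"]
    by (simp add: cyclic_ordering_def)
qed

text \<open>
  On the first block the square of the rotation is \<open>w_c \<circ> w_r\<close>, so compatibility is what makes
  the rotation a single cycle.
\<close>

lemma cyclic_ordering_alternating:
  fixes g :: "'a \<Rightarrow> 'a"
  assumes disj: "E \<inter> g ` E = {}" and gg: "\<And>a. a \<in> E \<Longrightarrow> g (g a) = a"
    and wr: "w_r permutes E" and wc: "w_c permutes E" and cyc: "cyclic_on (w_c \<circ> w_r) E"
  defines "\<rho> \<equiv> \<lambda>a. if a \<in> E then g (w_r a) else if a \<in> g ` E then w_c (g a) else a"
  shows "cyclic_ordering \<rho> (E \<union> g ` E)"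
proof -
  let ?S = "E \<union> g ` E"
  have \<rho>E: "\<rho> a = g (w_r a)" if "a \<in> E" for a using that by (simp add: \<rho>_def)
  have \<rho>N: "\<rho> (g b) = w_c b" if "b \<in> E" for b
    using that disj gg by (auto simp: \<rho>_def)
  have wrE: "w_r a \<in> E \<longleftrightarrow> a \<in> E" and wcE: "w_c a \<in> E \<longleftrightarrow> a \<in> E" for a
    using wr wc by (simp_all add: permutes_in_image)
  have sq: "\<rho> (\<rho> a) = (w_c \<circ> w_r) a" if "a \<in> E" for a
    using that by (simp add: \<rho>E \<rho>N wrE)
  obtain s where s: "s \<in> E" "E = orbit (w_c \<circ> w_r) s"
    using cyc by (auto simp: cyclic_on_def)
  have E_sub: "E \<subseteq> orbit \<rho> s"
  proof
    fix a assume "a \<in> E"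
    then have "a \<in> orbit (w_c \<circ> w_r) s" using s(2) by blast
    then show "a \<in> orbit \<rho> s"
    proof induction
      case base
      show ?case
        unfolding sq[OF s(1), symmetric] by (intro orbit.intros)
    next
      case (step a)
      then have "a \<in> E" using s(2) by blast
      show ?case
        unfolding sq[OF \<open>a \<in> E\<close>, symmetric] by (intro orbit.intros step.IH)
    qed
  qed
  have \<rho>_in: "\<rho> a \<in> ?S" if "a \<in> ?S" for a
    using that by (auto simp: \<rho>E \<rho>N wrE wcE)
  have orb: "orbit \<rho> s = ?S"
  proof (intro equalityI subsetI)
    fix a assume "a \<in> orbit \<rho> s"
    then show "a \<in> ?S" by induction (use \<rho>_in s(1) in blast)+
  next
    fix a assume "a \<in> ?S"
    then show "a \<in> orbit \<rho> s"
    proof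
      assume "a \<in> g ` E"
      then obtain b where b: "a = g b" "b \<in> E" by blast
      \<comment> \<open>The second block is reached in one step from the first, because
        \<open>w_r\<close> maps \<open>E\<close> onto itself.\<close>
      then obtain c where c: "b = w_r c" "c \<in> E"
        using permutes_image[OF wr] by blast
      then have "a = \<rho> c" using b \<rho>E by simp
      moreover have "c \<in> orbit \<rho> s" using E_sub c by blast
      ultimately show ?thesis by (simp add: orbit.step)
    qed (use E_sub in blast)
  qed
  have fin: "finite ?S"
    using finite_cyclic_on[OF cyc] by simp
  have "bij_betw \<rho> ?S ?S"
  proof -
    \<comment> \<open>On a finite set surjectivity is enough for a bijection.\<close>
    have "?S \<subseteq> \<rho> ` ?S"
    proof
      fix a assume "a \<in> ?S"
      then show "a \<in> \<rho> ` ?S"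
      proof
        assume "a \<in> E"
        then obtain b where "b \<in> E" "a = w_c b" using permutes_image[OF wc] by blast
        then show ?thesis by (intro image_eqI[where x = "g b"]) (simp_all add: \<rho>N)
      next
        assume "a \<in> g ` E"
        then have "a \<in> g ` w_r ` E" by (simp only: permutes_image[OF wr])
        then obtain b where "b \<in> E" "a = g (w_r b)" by blast
        then show ?thesis by (intro image_eqI[where x = b]) (simp_all add: \<rho>E)
      qed
    qed
    then have "\<rho> ` ?S = ?S" using \<rho>_in by blast
    then show ?thesis using fin by (simp add: bij_betw_def finite_surj_inj)
  qed
  then have "\<rho> permutes ?S"
    by (rule bij_imp_permutes) (simp add: \<rho>_def)
  moreover have "cyclic_on \<rho> ?S"
    using orb s(1) by (intro cyclic_on_singleI[of s]) auto
  ultimately show ?thesis by (simp add: cyclic_ordering_def)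
qed

theorem theorem2p8:
  fixes A :: pf_array and t m n h k :: nat and w_r w_c :: "int \<Rightarrow> int"
  assumes "quasi_heffter t m n h k A"
    and "compatible_orderings m n A w_r w_c"
  shows "\<exists>\<psi>. let v = 2 * n * k + t; K = complete_multipartite (v div t) t in
           cellular_embedding K \<psi> \<and> biembedding K \<psi> \<and>
           (\<forall>e\<in>parcs K. \<exists>F\<in>faces K \<psi>. \<exists>F'\<in>faces K \<psi>. F \<noteq> F' \<and>
              edge_on_face e F \<and> h dvd card F \<and>
              edge_on_face e F' \<and> k dvd card F') \<and>
           cyclic_regular v K \<psi>"
proof -
  define v where "v = 2 * n * k + t"
  define q where "q = v div t"
  define K where "K = complete_multipartite q t"
  define E where "E = entries m n A"
  define neg where "neg a = (- a) mod int v" for a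
  define S where "S = {a \<in> {0..<int v}. \<not> int q dvd a}"
  note str = quasi_heffter_structure[OF assms(1), folded v_def, folded q_def, folded S_def E_def]
  have t: "t > 0" and v: "v = q * t" and q: "q \<ge> 2" and inj: "inj_on (\<lambda>(i, j). the (A i j)) (filled_cells m n A)"
    using str by auto
  have N: "(\<lambda>a. (- a) mod int v) ` E = neg ` E" by (simp add: neg_def)
  have S_EN: "S = E \<union> neg ` E" and disj: "E \<inter> neg ` E = {}"
    using str(4,5) by (simp_all only: N)
  have q0: "q > 0" using q by simp
  have negneg: "neg (neg a) = a" if "a \<in> S" for a
    using that by (simp add: neg_def mod_minus_eq S_def)

  obtain wr where wr: "\<And>i. i < m \<Longrightarrow> cyclic_ordering (wr i) (row_entries n A i)"
      "w_r = foldr (\<circ>) (map wr [0..<m]) id"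
    using assms(2) by (auto simp: compatible_orderings_def row_ordering_def)
  obtain wc where wc: "\<And>j. j < n \<Longrightarrow> cyclic_ordering (wc j) (col_entries m A j)"
      "w_c = foldr (\<circ>) (map wc [0..<n]) id"
    using assms(2) by (auto simp: compatible_orderings_def col_ordering_def)
  have rows: "E = (\<Union>i\<in>set [0..<m]. row_entries n A i)"
    by (auto simp: E_def entries_def row_entries_def)
  have cols: "E = (\<Union>j\<in>set [0..<n]. col_entries m A j)"
    by (auto simp: E_def entries_def col_entries_def) blast
  have wrE: "w_r permutes E"
    unfolding rows wr(2) using wr(1) by (intro foldr_comp_permutes) (auto simp: cyclic_ordering_def)
  have wcE: "w_c permutes E"
    unfolding cols wc(2) using wc(1) by (intro foldr_comp_permutes) (auto simp: cyclic_ordering_def)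
  have wr_cyc: "cyclic_on w_r (row_entries n A i)" if "i < m" for i
    unfolding wr(2) using wr(1) line_entries(3)[OF inj] that by (rule cyclic_on_foldr_comp)
  have wc_cyc: "cyclic_on w_c (col_entries m A j)" if "j < n" for j
    unfolding wc(2) using wc(1) line_entries(4)[OF inj] that by (rule cyclic_on_foldr_comp)

  define r where "r = (\<lambda>a. if a \<in> E then neg (w_r a) else if a \<in> neg ` E then w_c (neg a) else a)"
  have r_cyc: "cyclic_ordering r S"
    unfolding r_def S_EN
  proof (rule cyclic_ordering_alternating[OF disj _ wrE wcE])
    show "cyclic_on (w_c \<circ> w_r) E"
      using assms(2) by (simp add: compatible_orderings_def cyclic_ordering_def E_def)
  qed (simp add: negneg S_EN)
  have "cyclic_cayley_graph K v S (multipartite_vertex q t)"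
    using cyclic_cayley_graph_complete_multipartite[OF q0 t] unfolding K_def S_def v .
  then interpret cyclic_cayley_map K v S "multipartite_vertex q t" r
    by (intro cyclic_cayley_map.intro cyclic_cayley_map_axioms.intro r_cyc)

  have label_step_neg: "label_step a = r (neg a)" for a
    by (simp only: label_step_def neg_def)
  \<comment> \<open>The sign from reversing an arc cancels the one built into \<open>r\<close>, so
    entries go to entries along column cycles; in \<open>step_N\<close> negatives go to negatives
    along row cycles.\<close>
  have step_E: "label_step a = w_c a" if "a \<in> E" for a
  proof -
    have "neg a \<notin> E" using that disj by auto
    then have "r (neg a) = w_c a"
      using that S_EN by (simp add: r_def negneg)
    then show ?thesis by (simp only: label_step_neg)
  qed
  have step_N: "label_step (neg b) = neg (w_r b)" if "b \<in> E" for b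
  proof -
    have "neg (neg b) = b" using that S_EN by (simp add: negneg)
    then show ?thesis
      using that unfolding label_step_neg by (simp add: r_def)
  qed
  have wrE': "w_r a \<in> E \<longleftrightarrow> a \<in> E" and wcE': "w_c a \<in> E \<longleftrightarrow> a \<in> E" for a
    using wrE wcE by (simp_all add: permutes_in_image)
  have step: "label_step a \<in> E \<longleftrightarrow> a \<in> E" if "a \<in> S" for a
    using that disj unfolding S_EN by (auto simp: step_E step_N wrE' wcE')
  have neg: "(- a) mod int v \<in> E \<longleftrightarrow> a \<notin> E" if "a \<in> S" for a
    using that disj negneg[of a] unfolding S_EN neg_def[symmetric] by (auto simp: negneg S_EN)

  have cell: "cellular_embedding K map_rotation"
    unfolding cellular_embedding_def
    using pair_graph_complete_multipartite connected_complete_multipartite[OF q t]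
      rotation_map_rotation by (simp add: K_def)
  have h: "h dvd card (orbit face_map d)" if d: "d \<in> parcs K" "label d \<notin> E" for d
  proof -
    obtain b where b: "label d = neg b" "b \<in> E"
      using label_in_S[OF d(1)] d(2) S_EN by auto
    then obtain i where i: "i < m" "b \<in> row_entries n A i"
      using rows by auto
    have sub: "row_entries n A i \<subseteq> E" using i(1) rows by auto
    \<comment> \<open>On negated entries \<open>label_step\<close> is \<open>w_r\<close> conjugated
      by \<open>neg\<close>, so the row of \<open>b\<close> gives a label cycle of \<open>h\<close>
      elements.\<close>
    have cyc: "cyclic_on label_step (neg ` row_entries n A i)"
      using wr_cyc[OF i(1)] by (rule cyclic_on_image) (use sub step_N in auto)
    have "inj_on neg (row_entries n A i)"
      by (rule inj_on_inverseI[where g = neg]) (use sub negneg S_EN in auto)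
    then have "card (neg ` row_entries n A i) = h"
      using line_entries(1)[OF inj i(1)] assms(1) i(1)
      by (simp add: card_image quasi_heffter_def Let_def)
    then show ?thesis
      using face_length_dvd[OF d(1) cyc] b i by auto
  qed
  have k: "k dvd card (orbit face_map d)" if d: "d \<in> parcs K" "label d \<in> E" for d
  proof -
    obtain j where j: "j < n" "label d \<in> col_entries m A j"
      using d(2) cols by auto
    have "a \<in> E" if "a \<in> col_entries m A j" for a
      using that j(1) cols by auto
    then have "cyclic_on label_step (col_entries m A j)"
      using wc_cyc[OF j(1)] step_E cyclic_cong[of "col_entries m A j" label_step w_c] by blast
    then show ?thesis
      using face_length_dvd[OF d(1) _ j(2)] line_entries(2)[OF inj j(1)] assms(1) j(1)
      by (simp add: quasi_heffter_def Let_def)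
  qed
  have lengths: "\<exists>F\<in>faces K map_rotation. \<exists>F'\<in>faces K map_rotation. F \<noteq> F' \<and>
      edge_on_face e F \<and> h dvd card F \<and> edge_on_face e F' \<and> k dvd card F'"
    if e: "e \<in> parcs K" for e
  proof -
    have lab: "label (prod.swap e) \<in> E \<longleftrightarrow> label e \<notin> E"
      using label_swap[OF e] neg[OF label_in_S[OF e]] by simp
    obtain d d' where d: "d \<in> {e, prod.swap e}" "label d \<notin> E"
      and d': "d' \<in> {e, prod.swap e}" "label d' \<in> E"
      using lab by blast
    have dK: "d \<in> parcs K" and d'K: "d' \<in> parcs K"
      using d(1) d'(1) e swap_in_parcs[OF e] by auto
    show ?thesis
    proof (intro bexI conjI)
      \<comment> \<open>Labels on one face are all in \<open>E\<close> or all outside it, and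
        \<open>d\<close>, \<open>d'\<close> lie on different sides.\<close>
      show "orbit face_map d \<noteq> orbit face_map d'"
        using face_label_invariant[OF d'K _ step] self_in_face[OF dK] d(2) d'(2) by blast
      show "edge_on_face e (orbit face_map d)" "edge_on_face e (orbit face_map d')"
        using self_in_face[OF dK] self_in_face[OF d'K] d(1) d'(1)
        by (auto simp: edge_on_face_def)
    qed (use h k d d' dK d'K in \<open>auto simp: faces_def\<close>)
  qed
  show ?thesis
    unfolding Let_def v_def[symmetric] q_def[symmetric] K_def[symmetric]
    using cell biembeddingI[OF cell step neg] lengths cyclic_regular_map by blast
qed

end
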